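(* For all $n \ge 8$, $N_{2,3}(n) = N_{2,3}(n-1) + N_{2,3}(n-5)$, with initial values $N_{2,3}(5)=1$, $N_{2,3}(6)=0$, $N_{2,3}(7)=0$ (and $N_{2,3}(n)=0$ for $n<5$).
   Context: For positive integers $a<b$ and $n \ge 3$, an $(a,b)$-necklace of length $n$ is a circular arrangement of the integers $0,1,\ldots,n-1$ (each used exactly once) such that any two adjacent entries have difference $\pm a$ or $\pm b$. Two necklaces are considered the same if one is obtained from the other by rotation or reflection. $N_{a,b}(n)$ denotes the number of distinct $(a,b)$-necklaces of length $n$; equivalently, it is the number of Hamiltonian cycles (as undirected subgraphs) of the graph on $\{0,1,\ldots,n-1\}$ in which $x,y$ are adjacent if and only if $|x-y| \in \{a,b\}$. *)

theory Defs
  imports Main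
begin

text \<open>
  A circular arrangement is represented by a list read off it: starting anywhere, in either
  direction. The index \<open>Suc i mod n\<close> makes the last entry adjacent to the first one.
  The guard \<open>3 \<le> n\<close> is part of the notion (necklaces have length at least 3); of the excluded
  lengths it only matters for \<open>n = 0\<close>, where the empty list would otherwise qualify.
\<close>

definition arrangements :: "nat \<Rightarrow> nat \<Rightarrow> nat \<Rightarrow> nat list set" where
  "arrangements a b n =
     {xs. 3 \<le> n \<and> length xs = n \<and> distinct xs \<and> set xs = {0..<n} \<and>
          (\<forall>i<n. \<bar>int (xs ! i) - int (xs ! (Suc i mod n))\<bar> \<in> {int a, int b})}"

definition same_necklace :: "nat \<Rightarrow> nat \<Rightarrow> nat \<Rightarrow> (nat list \<times> nat list) set" where
  "same_necklace a b n =
     {(xs, ys). xs \<in> arrangements a b n \<and> ys \<in> arrangements a b n \<and>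
                (\<exists>k. ys = rotate k xs \<or> ys = rev (rotate k xs))}"

definition necklaces :: "nat \<Rightarrow> nat \<Rightarrow> nat \<Rightarrow> nat list set set" where
  "necklaces a b n = arrangements a b n // same_necklace a b n"

definition num_necklaces :: "nat \<Rightarrow> nat \<Rightarrow> nat \<Rightarrow> nat" where
  "num_necklaces a b n = card (necklaces a b n)"

lemma rotate_inverse: "\<exists>l. rotate l (rotate k xs) = xs"
proof (cases "xs = []")
  case False
  have "rotate (length xs - k mod length xs) (rotate (k mod length xs) xs) = xs"
    using False by (simp add: rotate_rotate less_imp_le)
  then show ?thesis by (metis rotate_conv_mod)
qed simp

lemma rotate_rev_ex: "\<exists>l. rotate k (rev xs) = rev (rotate l xs)"
  by (metis rotate_rev rev_rev_ident)

lemma equiv_same_necklace: "equiv (arrangements a b n) (same_necklace a b n)"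
proof (rule equivI)
  show "same_necklace a b n \<subseteq> arrangements a b n \<times> arrangements a b n"
    by (auto simp: same_necklace_def)
  show "refl_on (arrangements a b n) (same_necklace a b n)"
    by (auto simp: refl_on_def same_necklace_def intro!: exI[of _ 0])
  show "sym (same_necklace a b n)"
  proof (rule symI)
    fix xs ys assume *: "(xs, ys) \<in> same_necklace a b n"
    then obtain k where "ys = rotate k xs \<or> ys = rev (rotate k xs)"
      by (auto simp: same_necklace_def)
    then have "rotate k xs = ys \<or> rotate k xs = rev ys" by auto
    then have "\<exists>l. xs = rotate l ys \<or> xs = rev (rotate l ys)"
      by (metis rotate_inverse rotate_rev_ex)
    with * show "(ys, xs) \<in> same_necklace a b n" by (auto simp: same_necklace_def)
  qed
  show "trans (same_necklace a b n)"
  proof (rule transI)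
    fix xs ys zs assume *: "(xs, ys) \<in> same_necklace a b n" "(ys, zs) \<in> same_necklace a b n"
    then obtain k l where "ys = rotate k xs \<or> ys = rev (rotate k xs)"
      "zs = rotate l ys \<or> zs = rev (rotate l ys)"
      by (auto simp: same_necklace_def)
    then have "\<exists>m. zs = rotate m xs \<or> zs = rev (rotate m xs)"
      by (metis rotate_rotate rotate_rev_ex rev_rev_ident)
    with * show "(xs, zs) \<in> same_necklace a b n" by (auto simp: same_necklace_def)
  qed
qed

end

theory Submission
  imports Defs
begin

text \<open>
  Cut each necklace open next to \<open>0\<close>, whose only possible neighbours are \<open>2\<close> and \<open>3\<close>: necklaces
  correspond to Hamiltonian paths from \<open>0\<close> to \<open>3\<close>. Strip such a path from its two ends, in
  increasing order of the vertices. Small vertices have so few remaining neighbours that what is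
  left is always a path with ends \<open>k, k + 1\<close> through all vertices \<open>\<ge> k\<close>, counted by \<open>A k\<close>, or one
  with ends \<open>k, k + 2\<close> omitting \<open>k + 1\<close>, counted by \<open>B k\<close>, and
  \<open>B k = [n = k + 3] + A (k + 2)\<close>, \<open>A k = A (k + 2) + B (k + 3) + B (k + 4)\<close>.
  The latter telescopes to \<open>A k = A (k + 1) + B (k + 3)\<close>. For \<open>n \<ge> 6\<close> the number of necklaces is
  \<open>B 2 = A 4 = A 5 + B 7\<close>, and translation turns \<open>A 5\<close> and \<open>B 7\<close> into the values of \<open>A 4 = B 2\<close>
  and \<open>B 2\<close> for \<open>n - 1\<close> and \<open>n - 5\<close>.
\<close>

section \<open>Hamiltonian paths with prescribed ends in an arbitrary graph\<close>

definition ham_paths :: "('a \<Rightarrow> 'a \<Rightarrow> bool) \<Rightarrow> 'a \<Rightarrow> 'a \<Rightarrow> 'a set \<Rightarrow> 'a list set" where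
  "ham_paths R s t V =
     {xs. xs \<noteq> [] \<and> hd xs = s \<and> last xs = t \<and> distinct xs \<and> set xs = V \<and> successively R xs}"

definition num_paths :: "('a \<Rightarrow> 'a \<Rightarrow> bool) \<Rightarrow> 'a \<Rightarrow> 'a \<Rightarrow> 'a set \<Rightarrow> nat" where
  "num_paths R s t V = card (ham_paths R s t V)"

lemma finite_ham_paths: "finite V \<Longrightarrow> finite (ham_paths R s t V)"
  by (rule finite_subset[OF _ finite_subset_distinct[of V]]) (auto simp: ham_paths_def)

lemma num_paths_eq_0_iff: "finite V \<Longrightarrow> num_paths R s t V = 0 \<longleftrightarrow> ham_paths R s t V = {}"
  by (simp add: num_paths_def finite_ham_paths)

lemma num_paths_endpoint_notin:
  assumes "s \<notin> V \<or> t \<notin> V"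
  shows "num_paths R s t V = 0"
proof -
  have "ham_paths R s t V = {}"
    using assms hd_in_set last_in_set by (fastforce simp: ham_paths_def)
  then show ?thesis by (simp add: num_paths_def)
qed

lemma ham_paths_same_endpoints:
  assumes "xs \<in> ham_paths R s s V"
  shows "xs = [s]"
  using assms by (cases xs) (auto simp: ham_paths_def split: if_splits)

lemma num_paths_same_endpoints:
  "num_paths R s s V = (if V = {s} then 1 else 0)"
proof -
  have "xs \<in> ham_paths R s s V \<longleftrightarrow> xs = [s] \<and> V = {s}" for xs
    using ham_paths_same_endpoints[of xs R s V] by (cases "xs = [s]") (auto simp: ham_paths_def)
  then have "ham_paths R s s V = (if V = {s} then {[s]} else {})" by auto
  then show ?thesis by (simp add: num_paths_def)
qed

lemma num_paths_same_endpoints_eq_0: "v \<in> V \<Longrightarrow> v \<noteq> s \<Longrightarrow> num_paths R s s V = 0"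
  by (auto simp: num_paths_same_endpoints)

lemma successively_rev_symp:
  assumes "symp R"
  shows "successively R (rev xs) \<longleftrightarrow> successively R xs"
proof -
  have "(\<lambda>x y. R y x) = R" using assms by (auto simp: fun_eq_iff dest: sympD)
  then show ?thesis by (metis successively_rev)
qed

lemma num_paths_commute:
  assumes "symp R"
  shows "num_paths R s t V = num_paths R t s V"
proof -
  have "rev ` ham_paths R s t V \<subseteq> ham_paths R t s V" for s t
    using successively_rev_symp[OF assms]
    by (auto simp: ham_paths_def hd_rev last_rev simp del: successively_rev)
  from this[of s t] this[of t s] have "bij_betw rev (ham_paths R s t V) (ham_paths R t s V)"
    by (intro bij_betw_byWitness[where f' = rev]) auto
  then show ?thesis by (simp add: num_paths_def bij_betw_same_card)
qed

text \<open>Applied to \<open>Suc\<close>, which preserves and reflects \<open>adj23\<close>, this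
  gives the translation invariance of the path counts.\<close>

lemma num_paths_image:
  assumes "inj f" and "\<And>x y. R (f x) (f y) \<longleftrightarrow> R x y"
  shows "num_paths R (f s) (f t) (f ` V) = num_paths R s t V"
proof -
  have "ham_paths R (f s) (f t) (f ` V) = map f ` ham_paths R s t V"
  proof (intro subset_antisym subsetI)
    fix ys assume ys: "ys \<in> ham_paths R (f s) (f t) (f ` V)"
    then have "set ys \<subseteq> range f" by (auto simp: ham_paths_def)
    then obtain xs where "ys = map f xs" by (metis subset_UNIV ex_map_conv subsetD rangeE)
    with ys assms show "ys \<in> map f ` ham_paths R s t V"
      by (auto simp: ham_paths_def hd_map last_map distinct_map successively_map
          inj_eq inj_image_eq_iff)
  qed (use assms in \<open>auto simp: ham_paths_def hd_map last_map distinct_map successively_map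
         intro: inj_on_subset[OF _ subset_UNIV]\<close>)
  moreover have "inj_on (map f) X" for X using assms(1) by (simp add: inj_on_subset[OF inj_mapI])
  ultimately show ?thesis by (simp add: num_paths_def card_image)
qed

lemma ham_paths_first_step:
  assumes "s \<noteq> t" "s \<in> V"
  shows "ham_paths R s t V = (\<Union>u\<in>{u. R s u}. (#) s ` ham_paths R u t (V - {s}))"
proof (intro subset_antisym subsetI)
  fix xs assume xs: "xs \<in> ham_paths R s t V"
  with assms obtain u ys where "xs = s # u # ys"
    by (cases xs; cases "tl xs") (auto simp: ham_paths_def)
  with xs show "xs \<in> (\<Union>u\<in>{u. R s u}. (#) s ` ham_paths R u t (V - {s}))"
    by (auto simp: ham_paths_def)
next
  fix xs assume "xs \<in> (\<Union>u\<in>{u. R s u}. (#) s ` ham_paths R u t (V - {s}))"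
  then obtain u ys where "R s u" "ys \<in> ham_paths R u t (V - {s})" "xs = s # ys" by blast
  with assms(2) show "xs \<in> ham_paths R s t V"
    by (simp add: ham_paths_def successively_Cons insert_absorb)
qed

text \<open>\<open>N\<close> may contain vertices outside \<open>V\<close>: they contribute 0. So
  one explicit \<open>N\<close> serves whether or not the larger neighbours lie below the bound
  \<open>n\<close>.\<close>

lemma num_paths_first_step:
  assumes "s \<noteq> t" "s \<in> V" "finite V" "finite N" "\<And>u. u \<in> N \<Longrightarrow> R s u"
    and "\<And>u. R s u \<Longrightarrow> u \<in> V \<Longrightarrow> u \<noteq> s \<Longrightarrow> u \<notin> N \<Longrightarrow> num_paths R u t (V - {s}) = 0"
  shows "num_paths R s t V = (\<Sum>u\<in>N. num_paths R u t (V - {s}))"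
proof -
  have "ham_paths R u t (V - {s}) = {}" if "R s u" "u \<notin> N" for u
    using assms that num_paths_endpoint_notin[of u "V - {s}" t R]
    by (cases "u \<in> V - {s}") (auto simp flip: num_paths_eq_0_iff)
  then have "ham_paths R s t V = (\<Union>u\<in>N. (#) s ` ham_paths R u t (V - {s}))"
    using assms(5) unfolding ham_paths_first_step[OF assms(1,2)] by blast
  moreover have "card \<dots> = (\<Sum>u\<in>N. card ((#) s ` ham_paths R u t (V - {s})))"
    using assms by (intro card_UN_disjoint) (auto simp: finite_ham_paths, auto simp: ham_paths_def)
  ultimately show ?thesis by (simp add: num_paths_def card_image)
qed

text \<open>An inner vertex of a path has two different neighbours in \<open>V\<close>, its
  predecessor and its successor.\<close>

lemma num_paths_dead_end:
  assumes "symp R" "v \<in> V" "v \<noteq> s" "v \<noteq> t" "\<And>u. u \<in> V \<Longrightarrow> R v u \<Longrightarrow> u = w"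
  shows "num_paths R s t V = 0"
proof -
  have "xs \<notin> ham_paths R s t V" for xs
  proof
    assume xs: "xs \<in> ham_paths R s t V"
    with assms(2) have "v \<in> set xs" by (simp add: ham_paths_def)
    then obtain ys zs where eq: "xs = ys @ v # zs" by (meson split_list)
    with xs assms(3,4) have "ys \<noteq> []" "zs \<noteq> []" by (auto simp: ham_paths_def)
    moreover from this xs eq have "R (last ys) v" "R v (hd zs)"
      by (auto simp: ham_paths_def successively_append_iff successively_Cons)
    moreover from calculation xs eq have "last ys \<in> V" "hd zs \<in> V" "last ys \<noteq> hd zs"
      by (auto simp: ham_paths_def) (metis disjoint_iff hd_in_set last_in_set)
    ultimately show False using assms(1,5) by (metis sympD)
  qed
  then have "ham_paths R s t V = {}" by blast
  then show ?thesis by (simp add: num_paths_def)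
qed

section \<open>Path counts in the graph of differences 2 and 3\<close>

definition adj23 :: "nat \<Rightarrow> nat \<Rightarrow> bool" where
  "adj23 x y \<longleftrightarrow> y = x + 2 \<or> y = x + 3 \<or> x = y + 2 \<or> x = y + 3"

lemma symp_adj23: "symp adj23"
  by (auto simp: adj23_def symp_def)

lemma adj23_iff: "adj23 x y \<longleftrightarrow> \<bar>int x - int y\<bar> \<in> {int 2, int 3}"
  by (auto simp: adj23_def)

abbreviation paths23 :: "nat \<Rightarrow> nat \<Rightarrow> nat set \<Rightarrow> nat" where
  "paths23 \<equiv> num_paths adj23"

text \<open>This is \<open>A k\<close> of the overview with the bound \<open>n\<close> made
  explicit; \<open>gap_ends\<close> is \<open>B k\<close>.\<close>

definition adjacent_ends :: "nat \<Rightarrow> nat \<Rightarrow> nat" where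
  "adjacent_ends k n = paths23 k (k + 1) {k..<n}"

definition gap_ends :: "nat \<Rightarrow> nat \<Rightarrow> nat" where
  "gap_ends k n = paths23 k (k + 2) ({k..<n} - {k + 1})"

lemma paths23_step:
  assumes "s \<noteq> t" "s \<in> V" "finite V" "finite N" "\<And>u. u \<in> N \<Longrightarrow> adj23 s u"
    and "\<And>u. adj23 s u \<Longrightarrow> u \<in> V \<Longrightarrow> u \<noteq> s \<Longrightarrow> u \<notin> N \<Longrightarrow> paths23 u t (V - {s}) = 0"
    and "V - {s} = W"
  shows "paths23 s t V = (\<Sum>u\<in>N. paths23 u t W)"
  using num_paths_first_step[of s t V N adj23] assms by simp

lemmas paths23_dead_end = num_paths_dead_end[OF symp_adj23]
lemmas paths23_commute = num_paths_commute[OF symp_adj23]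

text \<open>From \<open>k\<close> the path goes either to its end \<open>k + 2\<close>, which must
  then be the only vertex left, or to \<open>k + 3\<close>, leaving a path with adjacent ends read
  backwards.\<close>

lemma gap_ends_rec: "gap_ends k n = (if n = k + 3 then 1 else 0) + adjacent_ends (k + 2) n"
proof (cases "k + 2 < n")
  case True
  let ?W = "{k + 2..<n}"
  have "gap_ends k n = (\<Sum>u\<in>{k + 2, k + 3}. paths23 u (k + 2) ?W)"
    unfolding gap_ends_def using True by (intro paths23_step) (auto simp: adj23_def)
  also have "?W = {k + 2} \<longleftrightarrow> n = k + 3"
  proof
    assume "?W = {k + 2}"
    then have "k + 3 \<notin> ?W" by simp
    with True show "n = k + 3" by simp
  qed auto
  then have "(\<Sum>u\<in>{k + 2, k + 3}. paths23 u (k + 2) ?W) =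
      (if n = k + 3 then 1 else 0) + adjacent_ends (k + 2) n"
    by (simp add: num_paths_same_endpoints adjacent_ends_def paths23_commute numeral_eq_Suc)
  finally show ?thesis .
qed (simp add: gap_ends_def adjacent_ends_def num_paths_endpoint_notin)

text \<open>Among \<open>k\<close>, \<open>k + 1\<close>, \<open>k + 2\<close> the end
  \<open>k + 1\<close> has no neighbour.\<close>

lemma adjacent_ends_small: "n \<le> k + 3 \<Longrightarrow> adjacent_ends k n = 0"
proof (cases "k + 1 < n")
  case True
  assume "n \<le> k + 3"
  have "paths23 (k + 1) k {k..<n} = (\<Sum>u\<in>{}. paths23 u k ({k..<n} - {k + 1}))"
    using True \<open>n \<le> k + 3\<close> by (intro paths23_step) (auto simp: adj23_def)
  then show ?thesis by (simp add: adjacent_ends_def paths23_commute)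
qed (simp add: adjacent_ends_def num_paths_endpoint_notin)

text \<open>Vertex \<open>k\<close> can only be visited between \<open>k + 2\<close> and \<open>k + 3\<close>, so the path starts
  \<open>k + 2, k, k + 3\<close>.\<close>

lemma detour_low_end: "paths23 (k + 2) (k + 1) {k..<n} = gap_ends (k + 1) n"
proof (cases "k + 2 < n")
  case True
  have dead: "paths23 u (k + 1) ({k..<n} - {k + 2}) = 0" if "u \<noteq> k" for u
    using True that by (intro paths23_dead_end[of k _ _ _ "k + 3"]) (auto simp: adj23_def)
  have "paths23 (k + 2) (k + 1) {k..<n} = (\<Sum>u\<in>{k}. paths23 u (k + 1) ({k..<n} - {k + 2}))"
    using True dead by (intro paths23_step) (auto simp: adj23_def)
  also have "\<dots> = paths23 k (k + 1) ({k..<n} - {k + 2})" by simp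
  also have "\<dots> = (\<Sum>u\<in>{k + 3}. paths23 u (k + 1) ({k + 1..<n} - {k + 2}))"
    using True by (intro paths23_step) (auto simp: adj23_def)
  finally show ?thesis by (simp add: gap_ends_def paths23_commute numeral_eq_Suc)
qed (simp add: gap_ends_def num_paths_endpoint_notin)

text \<open>Vertex \<open>k + 1\<close> can only be visited between \<open>k + 3\<close> and \<open>k + 4\<close>, so the path starts
  \<open>k, k + 3, k + 1, k + 4\<close>.\<close>

lemma detour_high_end: "paths23 k (k + 2) {k..<n} = gap_ends (k + 2) n"
proof (cases "k + 3 < n")
  case True
  have dead: "paths23 u (k + 2) ({k + 1..<n} - {k + 3}) = 0" if "u \<noteq> k + 1" for u
    using True that by (intro paths23_dead_end[of "k + 1" _ _ _ "k + 4"]) (auto simp: adj23_def)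
  have "paths23 k (k + 2) {k..<n} = (\<Sum>u\<in>{k + 2, k + 3}. paths23 u (k + 2) {k + 1..<n})"
    using True by (intro paths23_step) (auto simp: adj23_def)
  also have "\<dots> = paths23 (k + 2) (k + 2) {k + 1..<n} + paths23 (k + 3) (k + 2) {k + 1..<n}"
    by simp
  also have "paths23 (k + 2) (k + 2) {k + 1..<n} = 0"
    using True by (intro num_paths_same_endpoints_eq_0[of "k + 1"]) auto
  also have "paths23 (k + 3) (k + 2) {k + 1..<n} =
      (\<Sum>u\<in>{k + 1}. paths23 u (k + 2) ({k + 1..<n} - {k + 3}))"
    using True dead by (intro paths23_step) (auto simp: adj23_def)
  also have "\<dots> = paths23 (k + 1) (k + 2) ({k + 1..<n} - {k + 3})" by simp
  also have "\<dots> = (\<Sum>u\<in>{k + 4}. paths23 u (k + 2) ({k + 2..<n} - {k + 3}))"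
    using True by (intro paths23_step) (auto simp: adj23_def)
  finally show ?thesis by (simp add: gap_ends_def paths23_commute numeral_eq_Suc)
next
  case False
  then have "gap_ends (k + 2) n = 0" by (simp add: gap_ends_def num_paths_endpoint_notin)
  moreover have "paths23 k (k + 2) {k..<n} = 0"
  proof (cases "k + 2 < n")
    case True
    \<comment> \<open>Here \<open>n = k + 3\<close> and \<open>k + 1\<close> is isolated, so the
      candidate neighbour \<open>0\<close> is a dummy.\<close>
    with False have "paths23 k (k + 2) {k..<n} = 0"
      by (intro paths23_dead_end[of "k + 1" _ _ _ 0]) (auto simp: adj23_def)
    then show ?thesis .
  qed (simp add: num_paths_endpoint_notin)
  ultimately show ?thesis by simp
qed

text \<open>Remove \<open>k\<close> and then the other end \<open>k + 1\<close>. The new ends are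
  \<open>k + 2\<close> or \<open>k + 3\<close> on one side and \<open>k + 3\<close> or
  \<open>k + 4\<close> on the other. Of the four pairs, two equal ends \<open>k + 3\<close> would
  miss \<open>k + 2\<close>, and the two pairs containing \<open>k + 4\<close> are the
  detours.\<close>

lemma adjacent_ends_step:
  assumes "k + 3 < n"
  shows "adjacent_ends k n = adjacent_ends (k + 2) n + gap_ends (k + 3) n + gap_ends (k + 4) n"
proof -
  let ?W = "{k + 2..<n}"
  have "adjacent_ends k n = (\<Sum>u\<in>{k + 2, k + 3}. paths23 u (k + 1) {k + 1..<n})"
    unfolding adjacent_ends_def using assms by (intro paths23_step) (auto simp: adj23_def)
  also have "\<dots> = paths23 (k + 1) (k + 2) {k + 1..<n} + paths23 (k + 1) (k + 3) {k + 1..<n}"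
    by (simp add: paths23_commute)
  also have "paths23 (k + 1) (k + 2) {k + 1..<n} = (\<Sum>u\<in>{k + 3, k + 4}. paths23 u (k + 2) ?W)"
    using assms by (intro paths23_step) (auto simp: adj23_def)
  also have "paths23 (k + 1) (k + 3) {k + 1..<n} = (\<Sum>u\<in>{k + 3, k + 4}. paths23 u (k + 3) ?W)"
    using assms by (intro paths23_step) (auto simp: adj23_def)
  also have "(\<Sum>u\<in>{k + 3, k + 4}. paths23 u (k + 2) ?W) =
      paths23 (k + 3) (k + 2) ?W + paths23 (k + 4) (k + 2) ?W" by simp
  also have "(\<Sum>u\<in>{k + 3, k + 4}. paths23 u (k + 3) ?W) =
      paths23 (k + 3) (k + 3) ?W + paths23 (k + 4) (k + 3) ?W" by simp
  also have "paths23 (k + 3) (k + 3) ?W = 0"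
    using assms by (intro num_paths_same_endpoints_eq_0[of "k + 2"]) auto
  also have "paths23 (k + 4) (k + 2) ?W = gap_ends (k + 4) n"
    using detour_high_end[of "k + 2" n] by (simp add: paths23_commute numeral_eq_Suc)
  also have "paths23 (k + 4) (k + 3) ?W = gap_ends (k + 3) n"
    using detour_low_end[of "k + 2" n] by (simp add: numeral_eq_Suc)
  finally show ?thesis by (simp add: adjacent_ends_def paths23_commute numeral_eq_Suc)
qed

lemma gap_ends_small: "n < k + 3 \<Longrightarrow> gap_ends k n = 0"
  by (simp add: gap_ends_def num_paths_endpoint_notin)

text \<open>The induction hypothesis at \<open>k + 1\<close> merges two terms of
  \<open>adjacent_ends_step\<close> into \<open>adjacent_ends (k + 1) n\<close>. For
  \<open>n \<le> k + 3\<close> all terms vanish.\<close>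

lemma adjacent_ends_rec: "adjacent_ends k n = adjacent_ends (k + 1) n + gap_ends (k + 3) n"
proof (induction "n - k" arbitrary: k rule: less_induct)
  case less
  show ?case
  proof (cases "k + 3 < n")
    case True
    then have "adjacent_ends (k + 1) n = adjacent_ends (k + 2) n + gap_ends (k + 4) n"
      using less[of "k + 1"] by (simp add: numeral_eq_Suc)
    with adjacent_ends_step[OF True] show ?thesis by simp
  qed (simp add: adjacent_ends_small gap_ends_small)
qed

lemma adjacent_ends_Suc: "adjacent_ends (Suc k) (Suc n) = adjacent_ends k n"
proof -
  have "paths23 (Suc k) (Suc (k + 1)) (Suc ` {k..<n}) = paths23 k (k + 1) {k..<n}"
    by (rule num_paths_image) (auto simp: adj23_def)
  then show ?thesis by (simp add: adjacent_ends_def)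
qed

lemma gap_ends_Suc: "gap_ends (Suc k) (Suc n) = gap_ends k n"
  using adjacent_ends_Suc[of "k + 2" n] by (simp add: gap_ends_rec)

text \<open>Going from 0 straight to the end 3 would miss 1, so the path goes to 2, and the low
  detour with \<open>k = 1\<close> applies.\<close>

lemma paths23_0_3:
  assumes "3 \<le> n"
  shows "paths23 0 3 {0..<n} = gap_ends 2 n"
proof (cases "n = 3")
  case False
  with assms have n: "3 < n" by simp
  have "paths23 0 3 {0..<n} = (\<Sum>u\<in>{2, 3}. paths23 u 3 {1..<n})"
    using n by (intro paths23_step) (auto simp: adj23_def)
  also have "\<dots> = paths23 2 3 {1..<n} + paths23 3 3 {1..<n}" by simp
  also have "paths23 3 3 {1..<n} = 0"
    using n by (intro num_paths_same_endpoints_eq_0[of 1]) auto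
  also have "paths23 2 3 {1..<n} = gap_ends 2 n"
    using detour_low_end[of 1 n] by (simp add: paths23_commute numeral_eq_Suc)
  finally show ?thesis by simp
qed (simp add: gap_ends_def num_paths_endpoint_notin)

section \<open>Necklaces as Hamiltonian paths from 0 to 3\<close>

lemma arrangements_2_3:
  "arrangements 2 3 n = {xs. 3 \<le> n \<and> length xs = n \<and> distinct xs \<and> set xs = {0..<n} \<and>
     successively adj23 xs \<and> adj23 (last xs) (hd xs)}"
proof -
  have "(\<forall>i<length xs. \<bar>int (xs ! i) - int (xs ! (Suc i mod length xs))\<bar> \<in> {int 2, int 3}) \<longleftrightarrow>
      successively adj23 xs \<and> adj23 (last xs) (hd xs)" if "3 \<le> length xs" for xs
  proof -
    have "xs \<noteq> []" using that by auto
    then obtain m where m: "length xs = Suc m" by (cases xs) auto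
    with \<open>xs \<noteq> []\<close> have ends: "last xs = xs ! m" "hd xs = xs ! 0"
      by (simp_all add: last_conv_nth hd_conv_nth)
    have "Suc i mod Suc m = Suc i" if "i < m" for i using that by (intro mod_less) simp
    then have "(\<forall>i<length xs. adj23 (xs ! i) (xs ! (Suc i mod length xs))) \<longleftrightarrow>
        (\<forall>i<m. adj23 (xs ! i) (xs ! Suc i)) \<and> adj23 (xs ! m) (xs ! 0)"
      by (auto simp: m less_Suc_eq)
    then show ?thesis by (simp only: successively_conv_nth ends adj23_iff m Suc_less_eq)
  qed
  then show ?thesis by (auto simp: arrangements_def)
qed

text \<open>The closing condition is automatic, because 3 and 0 are adjacent.\<close>

lemma ham_paths_0_3:
  assumes "3 \<le> n"
  shows "ham_paths adj23 0 3 {0..<n} = {xs \<in> arrangements 2 3 n. hd xs = 0 \<and> last xs = 3}"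
proof -
  have "length xs = n" if "distinct xs" "set xs = {0..<n}" for xs
    using distinct_card[OF that(1)] that(2) by simp
  with assms show ?thesis
    by (auto simp: ham_paths_def arrangements_2_3 adj23_def)
qed

lemma rotate_arrangements:
  assumes "xs \<in> arrangements a b n"
  shows "rotate k xs \<in> arrangements a b n"
proof -
  have n: "0 < n" and len: "length xs = n"
    using assms by (auto simp: arrangements_def)
  have "rotate k xs ! i = xs ! ((k + i) mod n)" if "i < n" for i
    using nth_rotate[of i xs k] that len by simp
  moreover have "(k + Suc i mod n) mod n = Suc ((k + i) mod n) mod n" for i
    by (simp add: mod_simps)
  moreover have "(k + i) mod n < n" for i using n by simp
  ultimately show ?thesis using assms n unfolding arrangements_def
    by (simp del: mod_Suc_eq insert_iff)
qed

lemma rev_arrangements_2_3: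
  assumes "xs \<in> arrangements 2 3 n"
  shows "rev xs \<in> arrangements 2 3 n"
  using assms successively_rev_symp[OF symp_adj23] sympD[OF symp_adj23]
  by (auto simp: arrangements_2_3 hd_rev last_rev simp del: successively_rev)

text \<open>Rotate 0 to the front. Its neighbours, the second and the last entry, are then 2 and 3
  in some order; a reflection puts 3 last.\<close>

lemma arrangement_canonical_rep:
  assumes "xs \<in> arrangements 2 3 n"
  obtains ys where "(xs, ys) \<in> same_necklace 2 3 n" "hd ys = 0" "last ys = 3"
proof -
  have "0 \<in> set xs" "3 \<le> n" using assms by (auto simp: arrangements_2_3)
  then obtain us vs where "xs = us @ 0 # vs" by (meson split_list)
  moreover define zs where "zs = vs @ us"
  ultimately have rot: "rotate (length us) xs = 0 # zs" by (simp add: rotate_append)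
  then have ar: "0 # zs \<in> arrangements 2 3 n"
    using rotate_arrangements[OF assms, of "length us"] by simp
  then have "2 \<le> length zs" by (auto simp: arrangements_2_3)
  then obtain z ws w where zs: "zs = z # ws @ [w]"
    by (cases zs; cases "tl zs" rule: rev_cases) auto
  with ar consider "w = 3" | "w = 2" "z = 3"
    by (auto simp: arrangements_2_3 adj23_def)
  then show thesis
  proof cases
    case 1
    have "(xs, 0 # zs) \<in> same_necklace 2 3 n"
      using ar assms unfolding same_necklace_def rot[symmetric] by blast
    with that 1 zs show thesis by simp
  next
    case 2
    \<comment> \<open>One more rotation moves 0 to the end, so that the reversal starts with 0
      again.\<close>
    have "rotate 1 (0 # zs) = zs @ [0]" by simp
    then have "rotate (1 + length us) xs = zs @ [0]" by (simp add: rot flip: rotate_rotate)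
    then have "rev (zs @ [0]) \<in> arrangements 2 3 n" "rev (zs @ [0]) = rev (rotate (1 + length us) xs)"
      using rotate_arrangements[OF assms] rev_arrangements_2_3 by metis+
    then have "(xs, rev (zs @ [0])) \<in> same_necklace 2 3 n"
      using assms unfolding same_necklace_def by blast
    with that 2 zs show thesis by simp
  qed
qed

text \<open>A rotation that keeps the first entry is trivial. A reflection that keeps it swaps its
  two cyclic neighbours, which differ as \<open>3 \<le> n\<close>, so it cannot keep the last
  entry.\<close>

lemma canonical_rep_unique:
  assumes "(xs, ys) \<in> same_necklace a b n"
    and ends: "hd xs = s" "last xs = t" "hd ys = s" "last ys = t"
  shows "ys = xs"
proof -
  from assms(1) have n: "3 \<le> n" "length xs = n" and dist: "distinct xs"
    by (auto simp: same_necklace_def arrangements_def)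
  from assms(1) obtain k where "ys = rotate k xs \<or> ys = rev (rotate k xs)"
    by (auto simp: same_necklace_def)
  then obtain k where k: "k < n" "ys = rotate k xs \<or> ys = rev (rotate k xs)"
    using n rotate_conv_mod[of k xs] by (metis mod_less_divisor not_numeral_le_zero gr0I)
  have ne: "xs \<noteq> []" using n by auto
  have hd_rot: "hd (rotate k xs) = xs ! k" using k n ne by (simp add: hd_rotate_conv_nth)
  from k(2) show ?thesis
  proof
    assume ys: "ys = rotate k xs"
    then have "xs ! k = xs ! 0" using hd_rot ends ne by (simp add: hd_conv_nth)
    then have "k = 0" using nth_eq_iff_index_eq[OF dist, of k 0] k n by simp
    with ys show ?thesis by simp
  next
    assume ys: "ys = rev (rotate k xs)"
    then have "xs ! k = xs ! (n - 1)" using hd_rot ends ne n by (simp add: last_rev last_conv_nth)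
    then have "k = n - 1" using nth_eq_iff_index_eq[OF dist, of k "n - 1"] k n by simp
    moreover have "last (rotate k xs) = xs ! ((k + (n - 1)) mod n)"
      using ne n nth_rotate[of "n - 1" xs k] by (simp add: last_conv_nth)
    moreover have "(n - 1 + (n - 1)) mod n = n - 2"
    proof -
      have "n - 1 + (n - 1) = n - 2 + n" using n by simp
      also have "\<dots> mod n = n - 2" using n unfolding mod_add_self2 by simp
      finally show ?thesis .
    qed
    ultimately have "xs ! (n - 2) = xs ! 0"
      using ys ends ne by (simp add: hd_rev hd_conv_nth)
    then have "n - 2 = 0" using nth_eq_iff_index_eq[OF dist, of "n - 2" 0] n by simp
    with n show ?thesis by simp
  qed
qed

text \<open>Each class contains exactly one list from 0 to 3, so taking classes is a bijection from
  these paths to the necklaces.\<close>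

lemma num_necklaces_eq_gap_ends:
  assumes "3 \<le> n"
  shows "num_necklaces 2 3 n = gap_ends 2 n"
proof -
  let ?S = "same_necklace 2 3 n"
  let ?C = "ham_paths adj23 0 3 {0..<n}"
  have C: "?C = {xs \<in> arrangements 2 3 n. hd xs = 0 \<and> last xs = 3}"
    by (rule ham_paths_0_3[OF assms])
  have "bij_betw (\<lambda>xs. ?S `` {xs}) ?C (necklaces 2 3 n)"
  proof (rule bij_betw_imageI)
    show "inj_on (\<lambda>xs. ?S `` {xs}) ?C"
    proof (rule inj_onI)
      fix xs ys assume *: "xs \<in> ?C" "ys \<in> ?C" "?S `` {xs} = ?S `` {ys}"
      then have "(xs, ys) \<in> ?S" using eq_equiv_class[OF *(3) equiv_same_necklace] C by blast
      with * show "xs = ys" using canonical_rep_unique C by blast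
    qed
    show "(\<lambda>xs. ?S `` {xs}) ` ?C = necklaces 2 3 n"
    proof (intro subset_antisym subsetI)
      fix X assume "X \<in> necklaces 2 3 n"
      then obtain xs where xs: "xs \<in> arrangements 2 3 n" "X = ?S `` {xs}"
        by (auto simp: necklaces_def elim: quotientE)
      obtain ys where ys: "(xs, ys) \<in> ?S" "hd ys = 0" "last ys = 3"
        using arrangement_canonical_rep[OF xs(1)] .
      then have "ys \<in> ?C" "X = ?S `` {ys}"
        using xs(2) equiv_class_eq[OF equiv_same_necklace ys(1)] C
        by (auto simp: same_necklace_def)
      then show "X \<in> (\<lambda>xs. ?S `` {xs}) ` ?C" by blast
    qed (auto simp: C necklaces_def intro: quotientI)
  qed
  then have "num_necklaces 2 3 n = paths23 0 3 {0..<n}"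
    unfolding num_necklaces_def num_paths_def by (metis bij_betw_same_card)
  with assms show ?thesis by (simp add: paths23_0_3)
qed

lemma num_necklaces_lt_3: "n < 3 \<Longrightarrow> num_necklaces a b n = 0"
  by (simp add: num_necklaces_def necklaces_def arrangements_def)

theorem mainTheorem5:
  shows "(\<forall>n\<ge>8. num_necklaces 2 3 n = num_necklaces 2 3 (n - 1) + num_necklaces 2 3 (n - 5)) \<and>
         num_necklaces 2 3 5 = 1 \<and>
         num_necklaces 2 3 6 = 0 \<and>
         num_necklaces 2 3 7 = 0 \<and>
         (\<forall>n<5. num_necklaces 2 3 n = 0)"
proof (intro conjI allI impI)
  fix n :: nat assume n: "8 \<le> n"
  define m where "m = n - 5"
  have m: "3 \<le> m" "n = m + 5" "n - 1 = m + 4" "n - 5 = m" using n by (auto simp: m_def)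
  have "gap_ends 2 (m + 5) = adjacent_ends 5 (m + 5) + gap_ends 7 (m + 5)"
    using m adjacent_ends_rec[of 4 "m + 5"] by (simp add: gap_ends_rec[of 2])
  also have "adjacent_ends 5 (m + 5) = adjacent_ends 4 (m + 4)"
    using adjacent_ends_Suc[of 4 "m + 4"] by (simp add: numeral_eq_Suc)
  \<comment> \<open>As \<open>3 \<le> m\<close>, the length \<open>m + 4\<close> is not 5 and the
    extra 1 in \<open>gap_ends_rec\<close> is absent.\<close>
  also have "\<dots> = gap_ends 2 (m + 4)"
    using m by (simp add: gap_ends_rec[of 2])
  also have "gap_ends 7 (m + 5) = gap_ends 2 m"
    by (simp add: gap_ends_Suc numeral_eq_Suc)
  finally show "num_necklaces 2 3 n = num_necklaces 2 3 (n - 1) + num_necklaces 2 3 (n - 5)"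
    unfolding m(3,4) using m(1,2) by (simp add: num_necklaces_eq_gap_ends)
next
  fix n :: nat assume "n < 5"
  then show "num_necklaces 2 3 n = 0"
    by (cases "n < 3") (auto simp: num_necklaces_lt_3 num_necklaces_eq_gap_ends gap_ends_small)
\<comment> \<open>For lengths 5, 6, 7 the term \<open>adjacent_ends 4 n\<close> is 0; only length 5
  gets the extra 1.\<close>
qed (simp_all add: num_necklaces_eq_gap_ends gap_ends_rec adjacent_ends_small)

end
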